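(* Let $q=e^{2\pi i\tau}$ with $\operatorname{Im}\tau>0$. Then: (a) $\varphi(q)\psi(q^2)=\psi^2(q)$; (b) $\varphi(q)-\varphi(-q)=4q\,\psi(q^8)$; (c) $\varphi(q)+\varphi(-q)=2\varphi(q^4)$; (d) $\varphi^2(q)-\varphi^2(-q)=8q\,\psi^2(q^4)$; (e) $\psi^2(q)-\varphi(-q)\psi(q^2)=4q\,\psi(q^2)\psi(q^8)$; (f) $\psi^2(q)+\varphi(-q)\psi(q^2)=2\psi(q^2)\varphi(q^4)$.
   Context: For complex $a,b$ with $|ab|<1$, Ramanujan's general theta function is $f(a,b)=\sum_{n=-\infty}^{\infty}a^{\frac{n(n+1)}{2}}b^{\frac{n(n-1)}{2}}$. For $|q|<1$, $\varphi(q)=f(q,q)=\sum_{n=-\infty}^{\infty}q^{n^2}$ and $\psi(q)=f(q,q^3)=\sum_{n=-\infty}^{\infty}q^{2n^2-n}$. Here $\varphi^2(q)$ and $\psi^2(q)$ mean $(\varphi(q))^2$ and $(\psi(q))^2$. *)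

theory Defs
  imports "HOL-Complex_Analysis.Complex_Analysis"
begin

(* Ramanujan's general theta function, meant for norm (a * b) < 1, where the bilateral
   series converges absolutely. Both exponents are nonnegative integers for every n
   and each div is exact. *)
definition ramanujan_f :: "complex \<Rightarrow> complex \<Rightarrow> complex" where
  "ramanujan_f a b =
     (\<Sum>\<^sub>\<infinity>n::int. a powi (n * (n + 1) div 2) * b powi (n * (n - 1) div 2))"

definition ramanujan_phi :: "complex \<Rightarrow> complex" where
  "ramanujan_phi q = ramanujan_f q q"

definition ramanujan_psi :: "complex \<Rightarrow> complex" where
  "ramanujan_psi q = ramanujan_f q (q ^ 3)"

lemma triangular_nonneg: "0 \<le> n * (n + 1) div (2::int)" "0 \<le> n * (n - 1) div (2::int)"
proof -
  have "0 \<le> n * (n + 1)" "0 \<le> n * (n - 1)"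
    by (cases "n \<ge> 0"; cases "n \<ge> 1"; simp add: zero_le_mult_iff)+
  then show "0 \<le> n * (n + 1) div 2" "0 \<le> n * (n - 1) div 2" by simp_all
qed

lemma triangular_double: "2 * (n * (n + 1) div (2::int)) = n * (n + 1)"
    "2 * (n * (n - 1) div (2::int)) = n * (n - 1)"
  by simp_all

lemma power_int_add_nonneg:
  fixes q :: complex
  assumes "0 \<le> (k::int)" "0 \<le> l"
  shows "q powi k * q powi l = q powi (k + l)"
  using assms by (simp add: power_int_def nat_add_distrib power_add)

lemma ramanujan_f_half_summable:
  fixes a b :: complex
  assumes "norm (a * b) < 1"
  shows "summable (\<lambda>n. norm (a powi (int n * (int n + 1) div 2) * b powi (int n * (int n - 1) div 2)))"
    (is "summable (\<lambda>n. norm (?t n))")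
proof -
  have step: "?t (Suc n) = ?t n * ((a * b) ^ n * a)" for n
  proof -
    have 1: "int (Suc n) * (int (Suc n) + 1) div 2 = int n * (int n + 1) div 2 + int (n + 1)"
      using triangular_double[of "int n"] triangular_double[of "int (Suc n)"]
      by (simp add: algebra_simps)
    have 2: "int (Suc n) * (int (Suc n) - 1) div 2 = int n * (int n - 1) div 2 + int n"
      using triangular_double[of "int n"] triangular_double[of "int (Suc n)"]
      by (simp add: algebra_simps)
    have "a powi (int n * (int n + 1) div 2 + int (n + 1)) =
        a powi (int n * (int n + 1) div 2) * a ^ (n + 1)"
      using power_int_add_nonneg[OF triangular_nonneg(1)[of "int n"] of_nat_0_le_iff[of "n + 1"], of a]
      by (simp only: power_int_of_nat)
    moreover have "b powi (int n * (int n - 1) div 2 + int n) =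
        b powi (int n * (int n - 1) div 2) * b ^ n"
      using power_int_add_nonneg[OF triangular_nonneg(2)[of "int n"] of_nat_0_le_iff[of n], of b]
      by (simp only: power_int_of_nat)
    ultimately show ?thesis
      unfolding 1 2 by (simp add: power_mult_distrib mult_ac)
  qed
  have "(\<lambda>n. norm ((a * b) ^ n * a)) \<longlonglongrightarrow> 0"
    using tendsto_norm_zero[OF tendsto_mult_left_zero[OF LIMSEQ_power_zero[OF assms], of a]] .
  then have "eventually (\<lambda>n. norm ((a * b) ^ n * a) < 1 / 2) sequentially"
    by (rule order_tendstoD) simp
  then obtain N where N: "\<And>n. n \<ge> N \<Longrightarrow> norm ((a * b) ^ n * a) < 1 / 2"
    by (auto simp: eventually_sequentially)
  show ?thesis
  proof (rule summable_ratio_test[of "1 / 2" N])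
    fix n assume "n \<ge> N"
    then have "norm (?t n) * norm ((a * b) ^ n * a) \<le> norm (?t n) * (1 / 2)"
      using N by (intro mult_left_mono) (auto intro: less_imp_le)
    then show "norm (norm (?t (Suc n))) \<le> 1 / 2 * norm (norm (?t n))"
      unfolding step norm_mult[of "?t n"] by (simp add: mult.commute)
  qed simp
qed

lemma ramanujan_f_abs_summable:
  fixes a b :: complex
  assumes "norm (a * b) < 1"
  shows "(\<lambda>n::int. norm (a powi (n * (n + 1) div 2) * b powi (n * (n - 1) div 2))) summable_on UNIV"
    (is "?f summable_on _")
proof -
  have "?f summable_on range int"
    by (subst summable_on_reindex)
       (use ramanujan_f_half_summable[OF assms] in
         \<open>auto simp: o_def intro!: norm_summable_imp_summable_on\<close>)
  moreover have "?f summable_on range (\<lambda>n. - int n)"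
  proof (subst summable_on_reindex)
    have "norm (b * a) < 1" using assms by (simp add: mult.commute)
    from ramanujan_f_half_summable[OF this]
    have "summable (\<lambda>n. norm (?f (- int n)))" by (simp add: algebra_simps)
    then show "(?f \<circ> (\<lambda>n. - int n)) summable_on UNIV"
      unfolding o_def by (intro norm_summable_imp_summable_on)
  qed (auto intro: injI)
  ultimately have "?f summable_on (range int \<union> (range (\<lambda>n. - int n) - range int))"
    by (intro summable_on_Un_disjoint) (auto intro: summable_on_subset_banach)
  moreover have "range int \<union> (range (\<lambda>n. - int n) - range int) = UNIV"
    by (auto simp: image_iff) (metis int_cases2)
  ultimately show ?thesis by simp
qed

lemma ramanujan_phi_series: "ramanujan_phi q = (\<Sum>\<^sub>\<infinity>n::int. q powi (n ^ 2))"
proof -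
  have "q powi (n * (n + 1) div 2) * q powi (n * (n - 1) div 2) = q powi (n ^ 2)" for n :: int
  proof -
    have "n * (n + 1) = n ^ 2 + n" "n * (n - 1) = n ^ 2 - n"
      by (simp_all add: algebra_simps power2_eq_square)
    then have "n * (n + 1) div 2 + n * (n - 1) div 2 = n ^ 2"
      using triangular_double[of n] by linarith
    then show ?thesis
      using power_int_add_nonneg[OF triangular_nonneg(1)[of n] triangular_nonneg(2)[of n], of q]
      by simp
  qed
  then show ?thesis by (simp add: ramanujan_phi_def ramanujan_f_def)
qed

lemma ramanujan_psi_series: "ramanujan_psi q = (\<Sum>\<^sub>\<infinity>n::int. q powi (2 * n ^ 2 - n))"
proof -
  have "q powi (n * (n + 1) div 2) * (q ^ 3) powi (n * (n - 1) div 2) = q powi (2 * n ^ 2 - n)"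
    for n :: int
  proof -
    have "n * (n + 1) = n ^ 2 + n" "n * (n - 1) = n ^ 2 - n"
      by (simp_all add: algebra_simps power2_eq_square)
    then have e: "n * (n + 1) div 2 + 3 * (n * (n - 1) div 2) = 2 * n ^ 2 - n"
      using triangular_double[of n] by linarith
    have "(q ^ 3) powi (n * (n - 1) div 2) = q powi (3 * (n * (n - 1) div 2))"
      by (simp add: power_int_mult)
    moreover have "0 \<le> 3 * (n * (n - 1) div 2)"
      using triangular_nonneg(2)[of n] by linarith
    ultimately show ?thesis
      using power_int_add_nonneg[OF triangular_nonneg(1)[of n], of "3 * (n * (n - 1) div 2)" q] e
      by simp
  qed
  then show ?thesis by (simp add: ramanujan_psi_def ramanujan_f_def)
qed

end

theory Submission
  imports Defs
begin

text \<open>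
  Everything follows from two rearrangements of absolutely convergent series, both driven by
  parity.

  Splitting \<open>\<phi>(q) = \<Sum> q\<^bsup>n\<^sup>2\<^esup>\<close> into even and odd \<open>n\<close>, the even part is \<open>\<phi>(q\<^sup>4)\<close>, while
  \<open>(2m + 1)\<^sup>2 = 8 \<cdot> m(m + 1)/2 + 1\<close> makes the odd part \<open>q\<close> times the series of \<open>q\<^sup>8\<close> over triangular
  exponents; this bilateral triangular series is \<open>f(x, 1)\<close> and equals \<open>2 \<psi>(x)\<close>
  (\<open>ramanujan_f_1_eq_psi\<close>). Changing the sign of \<open>q\<close> changes only the sign of the odd part
  (\<open>phi_even_odd_parts\<close>), so the sum and the
  difference of \<open>\<phi>(q)\<close> and \<open>\<phi>(-q)\<close> are twice the even and twice the odd part.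

  For \<open>\<phi>(q) \<psi>(q\<^sup>2) = \<psi>(q)\<^sup>2\<close>, the series for \<open>\<psi>(q)\<^sup>2\<close> is a sum over pairs \<open>(m, n)\<close> with exponent
  \<open>2m\<^sup>2 - m + 2n\<^sup>2 - n\<close>, which is \<open>u\<^sup>2 - u + v\<^sup>2\<close> for \<open>u = m + n\<close>, \<open>v = m - n\<close>. The only
  constraint is that \<open>u\<close> and \<open>v\<close> have the same parity. Since \<open>u\<^sup>2 - u\<close> is invariant under
  \<open>u \<mapsto> 1 - u\<close>, which swaps parities, the odd values of \<open>u\<close> can be replaced by even ones; then
  \<open>u = 2b\<close> and \<open>v\<close> range independently over all integers \<open>b\<close>, \<open>v\<close>, and the exponents
  \<open>v\<^sup>2 + 2(2b\<^sup>2 - b)\<close> are those of \<open>\<phi>(q) \<psi>(q\<^sup>2)\<close> (\<open>phi_times_psi_square\<close>).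

  The other three identities are algebra. The difference of squares factors into the sum and
  the difference above, whose product \<open>8q \<phi>(q\<^sup>4) \<psi>(q\<^sup>8)\<close> is \<open>8q \<psi>(q\<^sup>4)\<^sup>2\<close> by the product identity
  at \<open>q\<^sup>4\<close>. The last two are the sum and the difference multiplied by \<open>\<psi>(q\<^sup>2)\<close>, with
  \<open>\<phi>(q) \<psi>(q\<^sup>2)\<close> rewritten as \<open>\<psi>(q)\<^sup>2\<close>.
\<close>

lemma infsum_int_even_odd:
  fixes f :: "int \<Rightarrow> 'a :: banach"
  assumes "f summable_on UNIV"
  shows "(\<Sum>\<^sub>\<infinity>n. f n) = (\<Sum>\<^sub>\<infinity>m. f (2 * m)) + (\<Sum>\<^sub>\<infinity>m. f (2 * m + 1))"
proof -
  have U: "{n::int. even n} \<union> {n. odd n} = UNIV" by auto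
  have "infsum f ({n. even n} \<union> {n. odd n}) = infsum f {n. even n} + infsum f {n. odd n}"
    using assms by (intro infsum_Un_disjoint) (auto intro: summable_on_subset_banach)
  moreover have "(\<Sum>\<^sub>\<infinity>m. f (2 * m)) = infsum f {n. even n}"
    by (rule infsum_reindex_bij_witness[of _ "\<lambda>n. n div 2" "\<lambda>m. 2 * m"]) auto
  moreover have "(\<Sum>\<^sub>\<infinity>m. f (2 * m + 1)) = infsum f {n. odd n}"
    by (rule infsum_reindex_bij_witness[of _ "\<lambda>n. n div 2" "\<lambda>m. 2 * m + 1"]) auto
  ultimately show ?thesis unfolding U by simp
qed

lemma infsum_times_abs_summable:
  fixes f :: "'a \<Rightarrow> 'c :: {banach, real_normed_field}" and g :: "'b \<Rightarrow> 'c"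
  assumes "(\<lambda>x. norm (f x)) summable_on A" "(\<lambda>y. norm (g y)) summable_on B"
  shows "infsum f A * infsum g B = (\<Sum>\<^sub>\<infinity>(x, y)\<in>A \<times> B. f x * g y)"
proof -
  have "(\<lambda>p. norm (case p of (x, y) \<Rightarrow> f x * g y)) summable_on A \<times> B"
    unfolding Infinite_Sum.abs_summable_on_Sigma_iff using assms
    by (auto simp: norm_mult infsum_cmult_right' abs_mult infsum_nonneg
             intro!: summable_on_cmult_right summable_on_cmult_left)
  then have "(\<lambda>(x, y). f x * g y) summable_on A \<times> B"
    by (rule abs_summable_summable)
  then have "(\<Sum>\<^sub>\<infinity>x\<in>A. \<Sum>\<^sub>\<infinity>y\<in>B. f x * g y) = (\<Sum>\<^sub>\<infinity>(x, y)\<in>A \<times> B. f x * g y)"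
    by (rule infsum_Sigma'_banach)
  then show ?thesis
    by (simp add: infsum_cmult_right' infsum_cmult_left')
qed

lemma triangular_sums:
  fixes n :: int
  shows "n * (n + 1) div 2 + n * (n - 1) div 2 = n\<^sup>2"
    and "n * (n + 1) div 2 + 3 * (n * (n - 1) div 2) = 2 * n\<^sup>2 - n"
proof -
  have "n * (n + 1) = n\<^sup>2 + n" "n * (n - 1) = n\<^sup>2 - n"
    by (simp_all add: algebra_simps power2_eq_square)
  then show "n * (n + 1) div 2 + n * (n - 1) div 2 = n\<^sup>2"
    and "n * (n + 1) div 2 + 3 * (n * (n - 1) div 2) = 2 * n\<^sup>2 - n"
    using triangular_double[of n] by linarith+
qed

lemma psi_exponent_nonneg: "0 \<le> 2 * n\<^sup>2 - (n::int)"
  using triangular_nonneg[of n] triangular_sums(2)[of n] by linarith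

lemma phi_psi_series_abs_summable:
  fixes q :: complex
  assumes "norm q < 1"
  shows "(\<lambda>n::int. norm (q powi (n\<^sup>2))) summable_on UNIV"
    and "(\<lambda>n::int. norm (q powi (2 * n\<^sup>2 - n))) summable_on UNIV"
proof -
  have "q powi (n * (n + 1) div 2) * q powi (n * (n - 1) div 2) = q powi (n\<^sup>2)" for n :: int
    using triangular_nonneg[of n] by (simp add: power_int_add_nonneg triangular_sums)
  moreover have "norm (q * q) < 1"
    using assms by (simp add: norm_power power_less_one_iff flip: power2_eq_square)
  ultimately show "(\<lambda>n::int. norm (q powi (n\<^sup>2))) summable_on UNIV"
    using ramanujan_f_abs_summable[of q q] by simp
  have "q powi (n * (n + 1) div 2) * (q ^ 3) powi (n * (n - 1) div 2) = q powi (2 * n\<^sup>2 - n)"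
    for n :: int
    using triangular_nonneg[of n]
    by (simp add: power_int_power power_int_add_nonneg triangular_sums)
  moreover have "norm (q * q ^ 3) < 1"
    using assms by (simp add: norm_mult norm_power power_less_one_iff flip: power_Suc)
  ultimately show "(\<lambda>n::int. norm (q powi (2 * n\<^sup>2 - n))) summable_on UNIV"
    using ramanujan_f_abs_summable[of q "q ^ 3"] by simp
qed

text \<open>The triangular exponent \<open>n(n + 1)/2\<close> is \<open>m(2m + 1)\<close> at \<open>n = 2m\<close> and \<open>(2m + 1)(m + 1)\<close> at
  \<open>n = 2m + 1\<close>. These are the values of \<open>2k\<^sup>2 - k\<close> at \<open>k = -m\<close> and at \<open>k = m + 1\<close>, so each parity
  class contributes one copy of \<open>\<psi>(x)\<close>.\<close>

lemma ramanujan_f_1_eq_psi: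
  fixes x :: complex
  assumes "norm x < 1"
  shows "ramanujan_f x 1 = 2 * ramanujan_psi x"
proof -
  have "(\<lambda>n::int. x powi (n * (n + 1) div 2)) summable_on UNIV"
    using abs_summable_summable[OF ramanujan_f_abs_summable[of x 1]] assms by simp
  then have "ramanujan_f x 1 = (\<Sum>\<^sub>\<infinity>m::int. x powi (2 * m * (2 * m + 1) div 2))
      + (\<Sum>\<^sub>\<infinity>m::int. x powi ((2 * m + 1) * (2 * m + 1 + 1) div 2))"
    unfolding ramanujan_f_def by (simp add: infsum_int_even_odd)
  also have "(\<Sum>\<^sub>\<infinity>m::int. x powi (2 * m * (2 * m + 1) div 2)) = ramanujan_psi x"
    unfolding ramanujan_psi_series
    by (rule infsum_reindex_bij_witness[of _ uminus uminus])
       (auto simp: algebra_simps power2_eq_square)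
  also have "(\<Sum>\<^sub>\<infinity>m::int. x powi ((2 * m + 1) * (2 * m + 1 + 1) div 2)) = ramanujan_psi x"
    unfolding ramanujan_psi_series
  proof (rule infsum_reindex_bij_witness[of _ "\<lambda>m. m - 1" "\<lambda>m. m + 1"])
    fix m :: int
    have "(2 * m + 1) * (2 * m + 1 + 1) div 2 = (2 * m + 1) * (m + 1)"
      using nonzero_mult_div_cancel_left[of 2 "(2 * m + 1) * (m + 1)"]
      by (simp add: algebra_simps)
    then show "x powi (2 * (m + 1)\<^sup>2 - (m + 1)) = x powi ((2 * m + 1) * (2 * m + 1 + 1) div 2)"
      by (simp add: algebra_simps power2_eq_square)
  qed auto
  finally show ?thesis by simp
qed

lemma phi_even_odd_parts:
  fixes q :: complex
  assumes "norm q < 1"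
  shows "ramanujan_phi q = ramanujan_phi (q ^ 4) + 2 * q * ramanujan_psi (q ^ 8)"
proof -
  have even: "q powi ((2 * m)\<^sup>2) = (q ^ 4) powi (m\<^sup>2)" for m :: int
    by (simp add: power_int_power)
  have odd: "q powi ((2 * m + 1)\<^sup>2) = q * (q ^ 8) powi (m * (m + 1) div 2)" for m :: int
  proof -
    have "(2 * m + 1)\<^sup>2 = 1 + 4 * (m * (m + 1))"
      by (simp add: algebra_simps power2_eq_square)
    then have "(2 * m + 1)\<^sup>2 = 1 + 8 * (m * (m + 1) div 2)"
      using triangular_double(1)[of m] by linarith
    then show ?thesis
      using power_int_add_nonneg[of 1 "8 * (m * (m + 1) div 2)" q] triangular_nonneg(1)[of m]
      by (simp add: power_int_power)
  qed
  have "ramanujan_phi q = ramanujan_phi (q ^ 4) + q * ramanujan_f (q ^ 8) 1"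
    using infsum_int_even_odd[OF abs_summable_summable[OF phi_psi_series_abs_summable(1)[OF assms]]]
    unfolding even odd ramanujan_phi_series ramanujan_f_def
    by (simp add: infsum_cmult_right')
  moreover have "norm (q ^ 8) < 1"
    using assms by (simp add: norm_power power_less_one_iff)
  ultimately show ?thesis by (simp add: ramanujan_f_1_eq_psi)
qed

text \<open>The reindexing sends \<open>(m, n)\<close> to \<open>(v, b)\<close> with \<open>v = m - n\<close> and \<open>2b\<close> the even one of \<open>u\<close>
  and \<open>1 - u\<close>, where \<open>u = m + n\<close>. It is a bijection because \<open>u\<close> and \<open>v\<close> have the same parity, so
  that \<open>v\<close> records which of the two was taken.\<close>

lemma phi_times_psi_square:
  fixes q :: complex
  assumes "norm q < 1"
  shows "ramanujan_phi q * ramanujan_psi (q ^ 2) = (ramanujan_psi q)\<^sup>2"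
proof -
  define to_vb :: "int \<times> int \<Rightarrow> int \<times> int" where
    "to_vb = (\<lambda>(m, n). (m - n, if even (m + n) then (m + n) div 2 else (1 - (m + n)) div 2))"
  define of_vb :: "int \<times> int \<Rightarrow> int \<times> int" where
    "of_vb = (\<lambda>(v, b). let u = (if even v then 2 * b else 1 - 2 * b)
                        in ((u + v) div 2, (u - v) div 2))"
  have "norm (q ^ 2) < 1"
    using assms by (simp add: norm_power power_less_one_iff)
  note summable = phi_psi_series_abs_summable[OF assms] phi_psi_series_abs_summable(2)[OF this]
  have "(ramanujan_psi q)\<^sup>2
      = (\<Sum>\<^sub>\<infinity>(m, n)\<in>UNIV \<times> UNIV. q powi (2 * m\<^sup>2 - m) * q powi (2 * n\<^sup>2 - n))"
    unfolding ramanujan_psi_series power2_eq_square[of "infsum _ _"]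
    by (rule infsum_times_abs_summable) (fact summable)+
  also have "\<dots> = (\<Sum>\<^sub>\<infinity>(v, b)\<in>UNIV \<times> UNIV. q powi (v\<^sup>2) * (q ^ 2) powi (2 * b\<^sup>2 - b))"
  proof (rule infsum_reindex_bij_witness[of _ of_vb to_vb])
    fix p :: "int \<times> int"
    obtain m n where p: "p = (m, n)" by (cases p)
    show "of_vb (to_vb p) = p"
      unfolding p of_vb_def to_vb_def by (auto simp: Let_def)
    obtain v b where vb: "to_vb p = (v, b)" by (cases "to_vb p")
    have v: "v = m - n" and b: "2 * b = m + n \<or> 2 * b = 1 - (m + n)"
      using vb unfolding p to_vb_def by (auto split: if_splits)
    from b have "(2 * b)\<^sup>2 - 2 * b = (m + n)\<^sup>2 - (m + n)"
      by (elim disjE; simp only:) (simp add: power2_eq_square algebra_simps)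
    then have e: "v\<^sup>2 + 2 * (2 * b\<^sup>2 - b) = (2 * m\<^sup>2 - m) + (2 * n\<^sup>2 - n)"
      unfolding v by (simp add: power2_eq_square algebra_simps)
    have "q powi (v\<^sup>2) * (q ^ 2) powi (2 * b\<^sup>2 - b) = q powi (v\<^sup>2 + 2 * (2 * b\<^sup>2 - b))"
      using psi_exponent_nonneg[of b]
      by (subst power_int_add_nonneg[symmetric]) (simp_all add: power_int_power)
    also have "\<dots> = q powi (2 * m\<^sup>2 - m) * q powi (2 * n\<^sup>2 - n)"
      unfolding e
      by (rule power_int_add_nonneg[symmetric]) (fact psi_exponent_nonneg)+
    finally show "(case to_vb p of (v, b) \<Rightarrow> q powi (v\<^sup>2) * (q ^ 2) powi (2 * b\<^sup>2 - b))
        = (case p of (m, n) \<Rightarrow> q powi (2 * m\<^sup>2 - m) * q powi (2 * n\<^sup>2 - n))"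
      unfolding vb by (simp add: p)
  next
    fix p :: "int \<times> int"
    obtain v b where p: "p = (v, b)" by (cases p)
    show "to_vb (of_vb p) = p"
    proof (cases "even v")
      case True
      then obtain w where w: "v = 2 * w" by (elim evenE)
      have "(2 * b + v) div 2 = b + w" "(2 * b - v) div 2 = b - w"
        unfolding w by presburger+
      then have "of_vb p = (b + w, b - w)"
        unfolding p of_vb_def using True by (simp add: Let_def)
      then show ?thesis
        unfolding p to_vb_def w by simp
    next
      case False
      then obtain w where w: "v = 2 * w + 1" by (elim oddE)
      have "(1 - 2 * b + v) div 2 = 1 - b + w" "(1 - 2 * b - v) div 2 = - b - w"
        unfolding w by presburger+
      then have of: "of_vb p = (1 - b + w, - b - w)"
        unfolding p of_vb_def using False by (simp add: Let_def)
      have sum: "1 - b + w + (- b - w) = 1 - 2 * b" by simp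
      have "odd (1 - 2 * b)" by simp
      then show ?thesis
        unfolding of unfolding p to_vb_def w prod.case sum by simp
    qed
  qed auto
  also have "\<dots> = ramanujan_phi q * ramanujan_psi (q ^ 2)"
    unfolding ramanujan_phi_series ramanujan_psi_series
    by (rule infsum_times_abs_summable[symmetric]) (fact summable)+
  finally show ?thesis by simp
qed

theorem corollary3p3:
  fixes \<tau> q :: complex
  assumes "Im \<tau> > 0"
    and "q = exp (2 * of_real pi * \<i> * \<tau>)"
  shows "ramanujan_phi q * ramanujan_psi (q ^ 2) = (ramanujan_psi q) ^ 2
    \<and> ramanujan_phi q - ramanujan_phi (- q) = 4 * q * ramanujan_psi (q ^ 8)
    \<and> ramanujan_phi q + ramanujan_phi (- q) = 2 * ramanujan_phi (q ^ 4)
    \<and> (ramanujan_phi q) ^ 2 - (ramanujan_phi (- q)) ^ 2 = 8 * q * (ramanujan_psi (q ^ 4)) ^ 2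
    \<and> (ramanujan_psi q) ^ 2 - ramanujan_phi (- q) * ramanujan_psi (q ^ 2)
           = 4 * q * ramanujan_psi (q ^ 2) * ramanujan_psi (q ^ 8)
    \<and> (ramanujan_psi q) ^ 2 + ramanujan_phi (- q) * ramanujan_psi (q ^ 2)
           = 2 * ramanujan_psi (q ^ 2) * ramanujan_phi (q ^ 4)"
proof -
  have norm: "norm q < 1"
    using assms by (simp add: norm_exp_eq_Re)
  have "norm (q ^ 4) < 1"
    using norm by (simp add: norm_power power_less_one_iff)
  from phi_times_psi_square[OF this]
  have a4: "ramanujan_phi (q ^ 4) * ramanujan_psi (q ^ 8) = (ramanujan_psi (q ^ 4))\<^sup>2"
    by (simp flip: power_mult)
  note a = phi_times_psi_square[OF norm]
  note plus = phi_even_odd_parts[OF norm]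
  have minus: "ramanujan_phi (- q) = ramanujan_phi (q ^ 4) - 2 * q * ramanujan_psi (q ^ 8)"
    using phi_even_odd_parts[of "- q"] norm by simp
  have b: "ramanujan_phi q - ramanujan_phi (- q) = 4 * q * ramanujan_psi (q ^ 8)"
    and c: "ramanujan_phi q + ramanujan_phi (- q) = 2 * ramanujan_phi (q ^ 4)"
    unfolding plus minus by simp_all
  have "(ramanujan_phi q)\<^sup>2 - (ramanujan_phi (- q))\<^sup>2
      = (ramanujan_phi q - ramanujan_phi (- q)) * (ramanujan_phi q + ramanujan_phi (- q))"
    by (simp add: power2_eq_square algebra_simps)
  also have "\<dots> = 8 * q * (ramanujan_phi (q ^ 4) * ramanujan_psi (q ^ 8))"
    unfolding b c by simp
  finally have d: "(ramanujan_phi q)\<^sup>2 - (ramanujan_phi (- q))\<^sup>2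
      = 8 * q * (ramanujan_psi (q ^ 4))\<^sup>2"
    unfolding a4 .
  have "(ramanujan_psi q)\<^sup>2 - ramanujan_phi (- q) * ramanujan_psi (q ^ 2)
      = (ramanujan_phi q - ramanujan_phi (- q)) * ramanujan_psi (q ^ 2)"
    unfolding a[symmetric] by (simp only: left_diff_distrib)
  then have e: "(ramanujan_psi q)\<^sup>2 - ramanujan_phi (- q) * ramanujan_psi (q ^ 2)
      = 4 * q * ramanujan_psi (q ^ 2) * ramanujan_psi (q ^ 8)"
    unfolding b by (simp only: mult_ac)
  have "(ramanujan_psi q)\<^sup>2 + ramanujan_phi (- q) * ramanujan_psi (q ^ 2)
      = (ramanujan_phi q + ramanujan_phi (- q)) * ramanujan_psi (q ^ 2)"
    unfolding a[symmetric] by (simp only: distrib_right)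
  then have f: "(ramanujan_psi q)\<^sup>2 + ramanujan_phi (- q) * ramanujan_psi (q ^ 2)
      = 2 * ramanujan_psi (q ^ 2) * ramanujan_phi (q ^ 4)"
    unfolding c by (simp only: mult_ac)
  show ?thesis
    by (intro conjI) (fact a b c d e f)+
qed

end
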